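(* A Hausdorff abelian topological group $(G,\tau)$ is a UFSS group if and only if $(G,\tau)$ is locally minimal, locally GTG and NSS.
   Context: $\mathbb N=\{1,2,\dots\}$; neighborhoods are not necessarily open. For a symmetric subset $U\ni 0$ of an abelian group $G$ and $n\in\mathbb N$ put $(1/n)U=\{x\in G: kx\in U\ \text{for all } k\in\{1,\dots,n\}\}$. A Hausdorff topological group is UFSS (uniformly free from small subgroups) if for some neighborhood $U$ of $0$ (which may be taken symmetric) the sets $(1/n)U$, $n\in\mathbb N$, form a neighborhood basis at $0$. A symmetric subset $U\ni0$ of an abelian group $G$ is a GTG subset if the sets $(1/n)U$, $n\in\mathbb N$, form a basis of neighborhoods of zero for a (not necessarily Hausdorff) group topology on $G$. A Hausdorff abelian topological group is locally GTG if it has a basis of neighborhoods of $0$ formed by GTG subsets. A Hausdorff topological group $(G,\tau)$ is locally minimal if there exists a neighborhood $V$ of $0$ such that whenever $\sigma\le\tau$ is a Hausdorff group topology on $G$ such that $V$ is a $\sigma$-neighborhood of $0$, then $\sigma=\tau$. A topological group is NSS if some neighborhood of $0$ contains only the trivial subgroup. *)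

theory Defs
  imports "HOL-Analysis.Analysis"
begin

text \<open>
  The abelian group \<open>G\<close> is the full carrier of a type of class \<open>ab_group_add\<close>.  Its
  topologies are values of type \<open>'a topology\<close> rather than a type class instance, because
  several group topologies on the same group have to be compared.
\<close>

definition group_topology :: "'a::ab_group_add topology \<Rightarrow> bool" where
  "group_topology \<tau> \<longleftrightarrow>
     topspace \<tau> = UNIV \<and>
     continuous_map (prod_topology \<tau> \<tau>) \<tau> (\<lambda>(x, y). x + y) \<and>
     continuous_map \<tau> \<tau> uminus"

definition Hausdorff_group_topology :: "'a::ab_group_add topology \<Rightarrow> bool" where
  "Hausdorff_group_topology \<tau> \<longleftrightarrow> group_topology \<tau> \<and> Hausdorff_space \<tau>"

text \<open>Neighborhoods need not be open.\<close>

definition zero_nbhd :: "'a::zero topology \<Rightarrow> 'a set \<Rightarrow> bool" where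
  "zero_nbhd \<tau> U \<longleftrightarrow> (\<exists>W. openin \<tau> W \<and> 0 \<in> W \<and> W \<subseteq> U)"

definition zero_nbhd_basis :: "'a::zero topology \<Rightarrow> 'a set set \<Rightarrow> bool" where
  "zero_nbhd_basis \<tau> \<B> \<longleftrightarrow>
     (\<forall>B\<in>\<B>. zero_nbhd \<tau> B) \<and> (\<forall>V. zero_nbhd \<tau> V \<longrightarrow> (\<exists>B\<in>\<B>. B \<subseteq> V))"

definition symmetric_set :: "'a::ab_group_add set \<Rightarrow> bool" where
  "symmetric_set U \<longleftrightarrow> uminus ` U = U"

text \<open>
  The set \<open>(1/n)U\<close>.  The multiple \<open>kx\<close> is written as a sum of \<open>k\<close> copies of \<open>x\<close>.
\<close>

definition frac_set :: "nat \<Rightarrow> 'a::ab_group_add set \<Rightarrow> 'a set" where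
  "frac_set n U = {x. \<forall>k\<in>{1..n}. (\<Sum>i=1..k. x) \<in> U}"

definition UFSS :: "'a::ab_group_add topology \<Rightarrow> bool" where
  "UFSS \<tau> \<longleftrightarrow>
     Hausdorff_group_topology \<tau> \<and>
     (\<exists>U. symmetric_set U \<and> zero_nbhd \<tau> U \<and>
          zero_nbhd_basis \<tau> {frac_set n U | n. n \<ge> 1})"

definition GTG_subset :: "'a::ab_group_add set \<Rightarrow> bool" where
  "GTG_subset U \<longleftrightarrow>
     symmetric_set U \<and> 0 \<in> U \<and>
     (\<exists>\<sigma>. group_topology \<sigma> \<and> zero_nbhd_basis \<sigma> {frac_set n U | n. n \<ge> 1})"

definition locally_GTG :: "'a::ab_group_add topology \<Rightarrow> bool" where
  "locally_GTG \<tau> \<longleftrightarrow>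
     Hausdorff_group_topology \<tau> \<and>
     (\<exists>\<B>. zero_nbhd_basis \<tau> \<B> \<and> (\<forall>U\<in>\<B>. GTG_subset U))"

definition coarser_topology :: "'a topology \<Rightarrow> 'a topology \<Rightarrow> bool" where
  "coarser_topology \<sigma> \<tau> \<longleftrightarrow> (\<forall>W. openin \<sigma> W \<longrightarrow> openin \<tau> W)"

definition locally_minimal :: "'a::ab_group_add topology \<Rightarrow> bool" where
  "locally_minimal \<tau> \<longleftrightarrow>
     Hausdorff_group_topology \<tau> \<and>
     (\<exists>V. zero_nbhd \<tau> V \<and>
          (\<forall>\<sigma>. Hausdorff_group_topology \<sigma> \<and> coarser_topology \<sigma> \<tau> \<and> zero_nbhd \<sigma> V
               \<longrightarrow> \<sigma> = \<tau>))"

definition additive_subgroup :: "'a::ab_group_add set \<Rightarrow> bool" where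
  "additive_subgroup H \<longleftrightarrow>
     0 \<in> H \<and> (\<forall>x\<in>H. \<forall>y\<in>H. x + y \<in> H) \<and> (\<forall>x\<in>H. - x \<in> H)"

definition NSS :: "'a::ab_group_add topology \<Rightarrow> bool" where
  "NSS \<tau> \<longleftrightarrow>
     group_topology \<tau> \<and>
     (\<exists>U. zero_nbhd \<tau> U \<and> (\<forall>H. additive_subgroup H \<and> H \<subseteq> U \<longrightarrow> H = {0}))"

end

theory Submission
  imports Defs
begin

text \<open>
  If a coarser group topology \<open>\<sigma>\<close> has \<open>U\<close> as a neighborhood of \<open>0\<close>, then every \<open>(1/n)U\<close> is a
  \<open>\<sigma>\<close>-neighborhood as well, because multiplication by \<open>k\<close> is continuous.  When the \<open>(1/n)U\<close>
  form a basis for \<open>\<tau>\<close> this forces \<open>\<sigma> = \<tau>\<close>, so \<open>U\<close> witnesses local minimality.  The sets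
  \<open>(1/m)U\<close> are GTG subsets for the topology \<open>\<tau>\<close> itself, since \<open>(1/n)((1/m)U) \<subseteq> (1/n)U\<close> and the
  left-hand side is again a neighborhood of \<open>0\<close>.
  Conversely, a GTG subset \<open>W\<close> that is a \<open>\<tau>\<close>-neighborhood of \<open>0\<close> and lies inside both a neighborhood
  without nontrivial subgroups and one witnessing local minimality defines a group topology
  coarser than \<open>\<tau>\<close>.  It is Hausdorff, because any \<open>x\<close> in all \<open>(1/n)W\<close> generates a subgroup
  contained in \<open>W\<close>; hence it equals \<open>\<tau>\<close>, and \<open>W\<close> witnesses UFSS.
\<close>

section \<open>Continuity of the group operations and of multiples\<close>

lemma topspace_group_topology: "group_topology \<tau> \<Longrightarrow> topspace \<tau> = UNIV"
  by (simp add: group_topology_def)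

lemma continuous_map_group_add:
  assumes "group_topology \<tau>" "continuous_map X \<tau> f" "continuous_map X \<tau> g"
  shows "continuous_map X \<tau> (\<lambda>x. f x + g x)"
proof -
  have "continuous_map X (prod_topology \<tau> \<tau>) (\<lambda>x. (f x, g x))"
    using assms by (simp add: continuous_map_pairedI)
  moreover have "continuous_map (prod_topology \<tau> \<tau>) \<tau> (\<lambda>(x, y). x + y)"
    using assms by (simp add: group_topology_def)
  ultimately have "continuous_map X \<tau> ((\<lambda>(x, y). x + y) \<circ> (\<lambda>x. (f x, g x)))"
    by (rule continuous_map_compose)
  then show ?thesis by (simp add: o_def)
qed

lemma continuous_map_group_minus:
  assumes "group_topology \<tau>" "continuous_map X \<tau> f"
  shows "continuous_map X \<tau> (\<lambda>x. - f x)"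
proof -
  have "continuous_map X \<tau> (uminus \<circ> f)"
    using assms by (auto intro: continuous_map_compose simp: group_topology_def)
  then show ?thesis by (simp add: o_def)
qed

lemma continuous_map_group_diff:
  assumes "group_topology \<tau>" "continuous_map X \<tau> f" "continuous_map X \<tau> g"
  shows "continuous_map X \<tau> (\<lambda>x. f x - g x)"
  using continuous_map_group_add[OF assms(1,2) continuous_map_group_minus[OF assms(1,3)]]
  by simp

lemma continuous_map_group_const:
  assumes "group_topology \<tau>"
  shows "continuous_map X \<tau> (\<lambda>x. c)"
  using assms by (simp add: topspace_group_topology)

lemma continuous_map_group_multiple:
  fixes \<tau> :: "'a::ab_group_add topology"
  assumes "group_topology \<tau>"
  shows "continuous_map \<tau> \<tau> (\<lambda>x. \<Sum>i=1..k::nat. x)"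
proof (induction k)
  case 0
  then show ?case by (simp add: assms topspace_group_topology)
next
  case (Suc k)
  have "continuous_map \<tau> \<tau> (\<lambda>x. x)" by simp
  then have "continuous_map \<tau> \<tau> (\<lambda>x. (\<Sum>i=1..k. x) + x)"
    using Suc assms by (intro continuous_map_group_add)
  then show ?case by simp
qed

section \<open>Neighborhoods of 0 and the sets (1/n)U\<close>

lemma zero_nbhd_mono: "zero_nbhd \<tau> A \<Longrightarrow> A \<subseteq> B \<Longrightarrow> zero_nbhd \<tau> B"
  unfolding zero_nbhd_def by blast

lemma zero_nbhd_zero: "zero_nbhd \<tau> A \<Longrightarrow> 0 \<in> A"
  unfolding zero_nbhd_def by blast

lemma zero_nbhd_Int: "zero_nbhd \<tau> A \<Longrightarrow> zero_nbhd \<tau> B \<Longrightarrow> zero_nbhd \<tau> (A \<inter> B)"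
  unfolding zero_nbhd_def by (meson IntI Int_mono openin_Int)

lemma zero_nbhd_vimage:
  assumes "continuous_map \<tau> \<tau> f" "topspace \<tau> = UNIV" "f 0 = 0" "zero_nbhd \<tau> A"
  shows "zero_nbhd \<tau> (f -` A)"
proof -
  obtain W where W: "openin \<tau> W" "0 \<in> W" "W \<subseteq> A"
    using assms(4) unfolding zero_nbhd_def by blast
  have "openin \<tau> (f -` W)"
    using openin_continuous_map_preimage[OF assms(1) W(1)] assms(2) by (simp add: vimage_def)
  then show ?thesis
    unfolding zero_nbhd_def using W assms(3) by (intro exI[of _ "f -` W"]) auto
qed

lemma frac_set_0 [simp]: "frac_set 0 U = UNIV"
  by (simp add: frac_set_def)

text \<open>Exhibits (1/n)U as a finite intersection of preimages of U under multiplication maps,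
  built up from the whole group at index 0; the induction in \<open>zero_nbhd_frac_set\<close> runs
  along it.\<close>

lemma frac_set_Suc: "frac_set (Suc n) U = frac_set n U \<inter> (\<lambda>x. \<Sum>i=1..Suc n. x) -` U"
  unfolding frac_set_def by (auto simp: atLeastAtMostSuc_conv)

lemma frac_set_mono: "U \<subseteq> V \<Longrightarrow> frac_set n U \<subseteq> frac_set n V"
  by (auto simp: frac_set_def)

lemma frac_set_subset: "n \<ge> 1 \<Longrightarrow> frac_set n U \<subseteq> U"
  by (force simp: frac_set_def)

lemma zero_nbhd_frac_set:
  assumes "group_topology \<tau>" "zero_nbhd \<tau> U"
  shows "zero_nbhd \<tau> (frac_set n U)"
proof (induction n)
  case 0
  show ?case
    using openin_topspace[of \<tau>] topspace_group_topology[OF assms(1)]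
    by (auto simp: zero_nbhd_def)
next
  case (Suc n)
  have "zero_nbhd \<tau> ((\<lambda>x. \<Sum>i=1..Suc n. x) -` U)"
    using assms
    by (intro zero_nbhd_vimage continuous_map_group_multiple topspace_group_topology) simp_all
  with Suc show ?case
    unfolding frac_set_Suc by (rule zero_nbhd_Int)
qed

lemma symmetric_set_iff: "symmetric_set U \<longleftrightarrow> (\<forall>x\<in>U. - x \<in> U)"
  unfolding symmetric_set_def by (force simp: image_iff)

lemma symmetric_frac_set: "symmetric_set U \<Longrightarrow> symmetric_set (frac_set n U)"
  by (simp add: symmetric_set_iff frac_set_def sum_negf)

section \<open>Group topologies seen through their neighborhoods of 0\<close>

lemma openin_group_topology_iff:
  assumes "group_topology \<tau>"
  shows "openin \<tau> S \<longleftrightarrow> (\<forall>x\<in>S. zero_nbhd \<tau> {y. x + y \<in> S})"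
proof -
  \<comment> \<open>Translations are continuous, so the neighborhoods of 0 determine those of every
    point. This is why two group topologies can be compared at 0 alone.\<close>
  have translate: "openin \<tau> {y. x + y \<in> T}" if "openin \<tau> T" for x T
  proof -
    have "continuous_map \<tau> \<tau> (\<lambda>y. x + y)"
      using assms by (intro continuous_map_group_add continuous_map_group_const) auto
    from openin_continuous_map_preimage[OF this that] show ?thesis
      using assms by (simp add: topspace_group_topology)
  qed
  show ?thesis
  proof
    assume "openin \<tau> S"
    then show "\<forall>x\<in>S. zero_nbhd \<tau> {y. x + y \<in> S}"
      using translate unfolding zero_nbhd_def by force
  next
    assume *: "\<forall>x\<in>S. zero_nbhd \<tau> {y. x + y \<in> S}"
    show "openin \<tau> S"
    proof (subst openin_subopen, intro ballI)
      fix x assume "x \<in> S"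
      then obtain W where W: "openin \<tau> W" "0 \<in> W" "W \<subseteq> {y. x + y \<in> S}"
        using * unfolding zero_nbhd_def by blast
      \<comment> \<open>The set on the left is the translate x + W, written as a preimage so that
        \<open>translate\<close> shows it to be open.\<close>
      have "{y. - x + y \<in> W} \<subseteq> S"
      proof
        fix y assume "y \<in> {y. - x + y \<in> W}"
        then have "x + (- x + y) \<in> S" using W(3) by blast
        then show "y \<in> S" by simp
      qed
      then show "\<exists>T. openin \<tau> T \<and> x \<in> T \<and> T \<subseteq> S"
        using translate[OF W(1), of "- x"] W(2) by force
    qed
  qed
qed

lemma coarser_topology_if_zero_nbhd:
  assumes "group_topology \<sigma>" "group_topology \<tau>"
    and "\<And>A. zero_nbhd \<sigma> A \<Longrightarrow> zero_nbhd \<tau> A"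
  shows "coarser_topology \<sigma> \<tau>"
  using assms by (simp add: coarser_topology_def openin_group_topology_iff)

lemma coarser_topology_antisym:
  "coarser_topology \<sigma> \<tau> \<Longrightarrow> coarser_topology \<tau> \<sigma> \<Longrightarrow> \<sigma> = \<tau>"
  unfolding coarser_topology_def topology_eq by blast

text \<open>The topology with basis (1/n)U lies below every group topology that has U as a
  neighborhood of 0. Both directions of the equivalence rest on this.\<close>

lemma coarser_topology_frac_basis:
  assumes "group_topology \<sigma>" "group_topology \<tau>"
    and "zero_nbhd_basis \<sigma> {frac_set n U | n. n \<ge> 1}" "zero_nbhd \<tau> U"
  shows "coarser_topology \<sigma> \<tau>"
proof (rule coarser_topology_if_zero_nbhd[OF assms(1,2)])
  fix A assume "zero_nbhd \<sigma> A"
  then obtain n where "frac_set n U \<subseteq> A"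
    using assms(3) unfolding zero_nbhd_basis_def by blast
  then show "zero_nbhd \<tau> A"
    using zero_nbhd_frac_set[OF assms(2,4)] zero_nbhd_mono by blast
qed

lemma Hausdorff_space_group_topology:
  assumes "group_topology \<tau>" and "\<And>x. x \<noteq> 0 \<Longrightarrow> \<exists>A. zero_nbhd \<tau> A \<and> x \<notin> A"
  shows "Hausdorff_space \<tau>"
  unfolding Hausdorff_space_def
proof (intro allI impI)
  fix x y assume "x \<in> topspace \<tau> \<and> y \<in> topspace \<tau> \<and> x \<noteq> y"
  then have "x - y \<noteq> 0" by simp
  then obtain W where W: "openin \<tau> W" "0 \<in> W" "x - y \<notin> W"
    using assms(2) unfolding zero_nbhd_def by blast
  \<comment> \<open>This map sends (x, y) to 0 and every point of the diagonal to x - y. Since W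
    contains 0 but not x - y, the preimage of W is an open set around (x, y) that misses the
    diagonal, so any box A \<times> B inside it has disjoint sides.\<close>
  have "continuous_map (prod_topology \<tau> \<tau>) \<tau> (\<lambda>p. (x - y) - (fst p - snd p))"
    using assms(1)
    by (intro continuous_map_group_diff continuous_map_group_const continuous_map_fst
        continuous_map_snd)
  from openin_continuous_map_preimage[OF this W(1)]
  have "openin (prod_topology \<tau> \<tau>) {p. (x - y) - (fst p - snd p) \<in> W}"
    using assms(1) by (simp add: topspace_group_topology)
  moreover have "(x, y) \<in> {p. (x - y) - (fst p - snd p) \<in> W}" using W(2) by simp
  ultimately obtain A B where AB: "openin \<tau> A" "openin \<tau> B" "x \<in> A" "y \<in> B"
    "A \<times> B \<subseteq> {p. (x - y) - (fst p - snd p) \<in> W}"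
    unfolding openin_prod_topology_alt by meson
  have "disjnt A B"
    unfolding disjnt_iff
  proof (intro allI notI)
    fix z assume "z \<in> A \<and> z \<in> B"
    then have "(x - y) - (z - z) \<in> W" using AB(5) by force
    then show False using W(3) by simp
  qed
  then show "\<exists>U V. openin \<tau> U \<and> openin \<tau> V \<and> x \<in> U \<and> y \<in> V \<and> disjnt U V"
    using AB by blast
qed

section \<open>Separation from 0 and subgroups inside U\<close>

lemma Hausdorff_zero_nbhd_separates:
  assumes "Hausdorff_group_topology \<tau>" "x \<noteq> 0"
  shows "\<exists>A. zero_nbhd \<tau> A \<and> x \<notin> A"
proof -
  have "Hausdorff_space \<tau>" "topspace \<tau> = UNIV"
    using assms by (auto simp: Hausdorff_group_topology_def group_topology_def)
  then obtain A B where "openin \<tau> A" "0 \<in> A" "x \<in> B" "disjnt A B"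
    using assms(2) unfolding Hausdorff_space_def by (metis UNIV_I)
  then show ?thesis unfolding zero_nbhd_def disjnt_iff by blast
qed

lemma additive_subgroup_subset_frac_set:
  assumes "additive_subgroup H" "H \<subseteq> U"
  shows "H \<subseteq> frac_set n U"
proof
  fix x assume "x \<in> H"
  have "(\<Sum>i=1..k. x) \<in> H" for k :: nat
    using assms(1) \<open>x \<in> H\<close> by (induction k) (auto simp: additive_subgroup_def)
  then show "x \<in> frac_set n U" using assms(2) by (auto simp: frac_set_def)
qed

lemma additive_subgroup_Inter_frac_set:
  assumes "symmetric_set U" "0 \<in> U" and x: "\<And>n. x \<in> frac_set n U"
  shows "\<exists>H. additive_subgroup H \<and> H \<subseteq> U \<and> x \<in> H"
proof -
  define m where "m k = (\<Sum>i=1..k. x)" for k :: nat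
  have m0: "m 0 = 0" and mSuc: "m (Suc k) = m k + x" for k
    by (simp_all add: m_def)
  have madd: "m (j + k) = m j + m k" for j k
    by (induction k) (simp_all add: m0 mSuc add.assoc)
  have mU: "m k \<in> U" for k
  proof (cases "k = 0")
    case False
    then show ?thesis using x[of k] by (auto simp: frac_set_def m_def)
  qed (simp add: m0 assms(2))
  \<comment> \<open>The cyclic subgroup generated by x, written with differences of natural
    multiples. Each difference is plus or minus a single multiple of x, so symmetry of U keeps it in
    U.\<close>
  define H where "H = {m j - m k | j k. True}"
  have diff: "m j - m k \<in> U" for j k
  proof (cases "k \<le> j")
    case True
    then obtain d where "j = k + d" by (auto simp: le_iff_add)
    then show ?thesis using mU[of d] by (simp add: madd)
  next
    case False
    then have "j \<le> k" by simp
    then obtain d where "k = j + d" by (auto simp: le_iff_add)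
    then show ?thesis using mU[of d] assms(1) by (simp add: madd symmetric_set_iff)
  qed
  have "additive_subgroup H"
    unfolding additive_subgroup_def
  proof (intro conjI ballI)
    show "0 \<in> H" unfolding H_def by force
  next
    fix a b assume "a \<in> H" "b \<in> H"
    then obtain j k j' k' where ab: "a = m j - m k" "b = m j' - m k'" unfolding H_def by blast
    have "a + b = m (j + j') - m (k + k')" unfolding ab by (simp add: madd)
    then show "a + b \<in> H" unfolding H_def by blast
  next
    fix a assume "a \<in> H"
    then obtain j k where "a = m j - m k" unfolding H_def by blast
    then have "- a = m k - m j" by simp
    then show "- a \<in> H" unfolding H_def by blast
  qed
  moreover have "H \<subseteq> U" using diff unfolding H_def by blast
  moreover have "x \<in> H"
  proof -
    have "x = m 1 - m 0" by (simp add: m_def)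
    then show ?thesis unfolding H_def by blast
  qed
  ultimately show ?thesis by blast
qed

section \<open>The implications between UFSS and the three properties\<close>

lemma UFSS_imp_locally_minimal:
  assumes "UFSS \<tau>"
  shows "locally_minimal \<tau>"
proof -
  obtain U where U: "zero_nbhd \<tau> U" "zero_nbhd_basis \<tau> {frac_set n U | n. n \<ge> 1}"
    and \<tau>: "Hausdorff_group_topology \<tau>"
    using assms unfolding UFSS_def by blast
  \<comment> \<open>The missing inclusion is \<open>coarser_topology_frac_basis\<close> with the
    roles of \<sigma> and \<tau> exchanged.\<close>
  have "\<sigma> = \<tau>"
    if "Hausdorff_group_topology \<sigma>" "coarser_topology \<sigma> \<tau>" "zero_nbhd \<sigma> U" for \<sigma>
    using that \<tau> U(2)
    by (intro coarser_topology_antisym)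
      (auto intro: coarser_topology_frac_basis simp: Hausdorff_group_topology_def)
  then show ?thesis unfolding locally_minimal_def using \<tau> U(1) by blast
qed

lemma UFSS_imp_locally_GTG:
  assumes "UFSS \<tau>"
  shows "locally_GTG \<tau>"
proof -
  obtain U where U: "symmetric_set U" "zero_nbhd \<tau> U"
      "zero_nbhd_basis \<tau> {frac_set n U | n. n \<ge> 1}"
    and \<tau>: "Hausdorff_group_topology \<tau>"
    using assms unfolding UFSS_def by blast
  have grp: "group_topology \<tau>" using \<tau> by (simp add: Hausdorff_group_topology_def)
  have "GTG_subset (frac_set m U)" if "m \<ge> 1" for m
  proof -
    have nb: "zero_nbhd \<tau> (frac_set n (frac_set m U))" for n
      using grp U(2) by (intro zero_nbhd_frac_set)
    have "\<exists>B\<in>{frac_set n (frac_set m U) | n. n \<ge> 1}. B \<subseteq> V" if V: "zero_nbhd \<tau> V" for V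
    proof -
      obtain n where "n \<ge> 1" "frac_set n U \<subseteq> V"
        using U(3) V unfolding zero_nbhd_basis_def by blast
      moreover have "frac_set n (frac_set m U) \<subseteq> frac_set n U"
        using \<open>m \<ge> 1\<close> by (intro frac_set_mono frac_set_subset)
      ultimately show ?thesis by blast
    qed
    then have "zero_nbhd_basis \<tau> {frac_set n (frac_set m U) | n. n \<ge> 1}"
      unfolding zero_nbhd_basis_def using nb by auto
    then show ?thesis
      unfolding GTG_subset_def
      using grp symmetric_frac_set[OF U(1)] zero_nbhd_zero[OF zero_nbhd_frac_set[OF grp U(2)]]
      by blast
  qed
  then show ?thesis unfolding locally_GTG_def using \<tau> U(3) by blast
qed

lemma UFSS_imp_NSS:
  assumes "UFSS \<tau>"
  shows "NSS \<tau>"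
proof -
  obtain U where U: "zero_nbhd \<tau> U" "zero_nbhd_basis \<tau> {frac_set n U | n. n \<ge> 1}"
    and \<tau>: "Hausdorff_group_topology \<tau>"
    using assms unfolding UFSS_def by blast
  have "H = {0}" if H: "additive_subgroup H" "H \<subseteq> U" for H
  proof -
    \<comment> \<open>H lies in every (1/n)U, while in a Hausdorff group these basic neighborhoods
      have only 0 in common.\<close>
    have "x = 0" if "x \<in> H" for x
    proof (rule ccontr)
      assume "x \<noteq> 0"
      then obtain A where "zero_nbhd \<tau> A" "x \<notin> A"
        using Hausdorff_zero_nbhd_separates[OF \<tau>] by blast
      then obtain n where "x \<notin> frac_set n U"
        using U(2) unfolding zero_nbhd_basis_def by blast
      then show False using additive_subgroup_subset_frac_set[OF H] \<open>x \<in> H\<close> by blast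
    qed
    then show ?thesis using H(1) unfolding additive_subgroup_def by blast
  qed
  then show ?thesis
    unfolding NSS_def using \<tau> U(1) by (auto simp: Hausdorff_group_topology_def)
qed

lemma UFSS_if_locally_minimal_GTG_NSS:
  assumes "locally_minimal \<tau>" "locally_GTG \<tau>" "NSS \<tau>"
  shows "UFSS \<tau>"
proof -
  have \<tau>: "Hausdorff_group_topology \<tau>" using assms(1) by (simp add: locally_minimal_def)
  obtain V where V: "zero_nbhd \<tau> V"
    and minimal: "\<And>\<sigma>. \<lbrakk>Hausdorff_group_topology \<sigma>; coarser_topology \<sigma> \<tau>; zero_nbhd \<sigma> V\<rbrakk> \<Longrightarrow> \<sigma> = \<tau>"
    using assms(1) unfolding locally_minimal_def by blast
  obtain U where U: "zero_nbhd \<tau> U" "\<And>H. additive_subgroup H \<Longrightarrow> H \<subseteq> U \<Longrightarrow> H = {0}"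
    using assms(3) unfolding NSS_def by blast
  obtain W where W: "GTG_subset W" "zero_nbhd \<tau> W" "W \<subseteq> U \<inter> V"
    using assms(2) zero_nbhd_Int[OF U(1) V] unfolding locally_GTG_def zero_nbhd_basis_def by meson
  obtain \<sigma> where \<sigma>: "group_topology \<sigma>" "zero_nbhd_basis \<sigma> {frac_set n W | n. n \<ge> 1}"
    and sym: "symmetric_set W" "0 \<in> W"
    using W(1) unfolding GTG_subset_def by blast
  have nb: "zero_nbhd \<sigma> (frac_set n W)" if "n \<ge> 1" for n
    using \<sigma>(2) that unfolding zero_nbhd_basis_def by blast
  have "Hausdorff_space \<sigma>"
  proof (rule Hausdorff_space_group_topology[OF \<sigma>(1)])
    fix x :: 'a assume "x \<noteq> 0"
    then have "\<nexists>H. additive_subgroup H \<and> H \<subseteq> W \<and> x \<in> H"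
      using U(2) W(3) by blast
    then obtain n where n: "x \<notin> frac_set n W"
      using additive_subgroup_Inter_frac_set[OF sym] by blast
    \<comment> \<open>Index 0 is excluded because \<open>frac_set 0 W\<close> is the whole
      group.\<close>
    then have "n \<ge> 1" by (cases n) auto
    then show "\<exists>A. zero_nbhd \<sigma> A \<and> x \<notin> A" using nb n by blast
  qed
  moreover have "coarser_topology \<sigma> \<tau>"
    using coarser_topology_frac_basis[OF \<sigma>(1) _ \<sigma>(2) W(2)] \<tau>
    by (simp add: Hausdorff_group_topology_def)
  \<comment> \<open>The basic \<sigma>-neighborhood with n = 1 is contained in W, hence in
    V.\<close>
  moreover have "zero_nbhd \<sigma> V"
    using zero_nbhd_mono[OF nb[of 1]] frac_set_subset[of 1 W] W(3) by blast
  ultimately have "\<sigma> = \<tau>"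
    using minimal \<sigma>(1) by (simp add: Hausdorff_group_topology_def)
  then show ?thesis unfolding UFSS_def using \<tau> \<sigma>(2) sym(1) W(2) by blast
qed

theorem theorem5p10:
  fixes \<tau> :: "'a::ab_group_add topology"
  assumes "Hausdorff_group_topology \<tau>"
  shows "UFSS \<tau> \<longleftrightarrow> locally_minimal \<tau> \<and> locally_GTG \<tau> \<and> NSS \<tau>"
  using UFSS_imp_locally_minimal UFSS_imp_locally_GTG UFSS_imp_NSS
    UFSS_if_locally_minimal_GTG_NSS by blast

end
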